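(* Consider the set of Dyck paths such that no peak and no valley has positive, even height. For every $n \geq 1$, the number of such paths of semilength $2n$ is $\binom{2n-1}{n}$, and for every $n \geq 0$, the number of such paths of semilength $2n+1$ is $\binom{2n}{n}$.
   Context: A Dyck path is a finite (possibly empty) word in the letters $U$ (standing for $+1$) and $D$ (standing for $-1$) whose partial sums are all nonnegative and whose total sum is $0$. A Dyck path of length $2n$ is said to have semilength $n$. The height of a path at position $k$ is the sum of its first $k$ terms. A peak at height $h$ is an occurrence of two consecutive steps $UD$ such that the height of the path right after the $U$ is $h$. A valley at height $h$ is an occurrence of two consecutive steps $DU$ such that the height of the path right after the $D$ is $h$. By convention the empty path has a peak at height $0$ and no valley. *)

theory Defs
  imports Complex_Main
begin

datatype step = U | D

fun step_value :: "step \<Rightarrow> int" where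
  "step_value U = 1"
| "step_value D = -1"

definition height :: "step list \<Rightarrow> nat \<Rightarrow> int" where
  "height p k = (\<Sum>s\<leftarrow>take k p. step_value s)"

definition dyck_path :: "step list \<Rightarrow> bool" where
  "dyck_path p \<longleftrightarrow> (\<forall>k\<le>length p. height p k \<ge> 0) \<and> height p (length p) = 0"

definition has_semilength :: "step list \<Rightarrow> nat \<Rightarrow> bool" where
  "has_semilength p n \<longleftrightarrow> length p = 2 * n"

(* By convention, the empty path has a peak at height 0 (and no valley). *)
definition peak_at_height :: "step list \<Rightarrow> int \<Rightarrow> bool" where
  "peak_at_height p h \<longleftrightarrow>
     (p = [] \<and> h = 0) \<or>
     (\<exists>i. Suc i < length p \<and> p ! i = U \<and> p ! Suc i = D \<and> height p (Suc i) = h)"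

definition valley_at_height :: "step list \<Rightarrow> int \<Rightarrow> bool" where
  "valley_at_height p h \<longleftrightarrow>
     (\<exists>i. Suc i < length p \<and> p ! i = D \<and> p ! Suc i = U \<and> height p (Suc i) = h)"

definition no_positive_even_peak_or_valley :: "step list \<Rightarrow> bool" where
  "no_positive_even_peak_or_valley p \<longleftrightarrow>
     (\<forall>h. h > 0 \<and> even h \<longrightarrow> \<not> peak_at_height p h \<and> \<not> valley_at_height p h)"

end

theory Submission
  imports Defs
begin

text \<open>
  Even heights occur exactly at even positions, so the condition says that the steps number
  \<open>2k\<close> and \<open>2k + 1\<close> agree unless the path is at height \<open>0\<close> between them. Reading the path after
  its first step in such pairs, the odd heights \<open>2y + 1\<close> perform a walk on the levels \<open>y \<ge> 0\<close>
  with steps \<open>\<plusminus>1\<close> and an additional stationary step at \<open>y = 0\<close>. Identifying \<open>y\<close> with \<open>-1 - y\<close>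
  folds the simple walk on the integers onto this walk, and only one of the two points has the
  right parity: there are \<open>N choose ((N - y) div 2)\<close> walks of length \<open>N\<close> from level \<open>y \<le> N\<close> to
  level \<open>0\<close>.
\<close>

text \<open>The starting height is an argument so that a path can be cut anywhere and its remainder
  examined by recursion. Peaks and valleys share one condition, on unequal neighbours.\<close>

fun admissible :: "int \<Rightarrow> step list \<Rightarrow> bool" where
  "admissible h [] \<longleftrightarrow> h = 0"
| "admissible h [s] \<longleftrightarrow> 0 \<le> h \<and> h + step_value s = 0"
| "admissible h (s # t # p) \<longleftrightarrow>
     0 \<le> h \<and> (s \<noteq> t \<and> 0 < h + step_value s \<longrightarrow> odd (h + step_value s)) \<and>
     admissible (h + step_value s) (t # p)"

lemma height_0 [simp]: "height p 0 = 0"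
  by (simp add: height_def)

lemma height_Cons_Suc [simp]: "height (s # p) (Suc k) = step_value s + height p k"
  by (simp add: height_def)

lemma all_le_Suc_iff: "(\<forall>k\<le>Suc n. P k) \<longleftrightarrow> P 0 \<and> (\<forall>k\<le>n. P (Suc k))"
  by (metis Suc_le_mono not0_implies_Suc zero_le)

lemma all_nat_iff: "(\<forall>k. P k) \<longleftrightarrow> P 0 \<and> (\<forall>k. P (Suc k))"
  by (metis not0_implies_Suc)

lemma admissible_iff:
  "admissible h p \<longleftrightarrow>
     (\<forall>k\<le>length p. 0 \<le> h + height p k) \<and> h + height p (length p) = 0 \<and>
     (\<forall>i. Suc i < length p \<and> p ! i \<noteq> p ! Suc i \<and> 0 < h + height p (Suc i) \<longrightarrow>
          odd (h + height p (Suc i)))"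
proof (induction h p rule: admissible.induct)
  case (1 h)
  then show ?case by auto
next
  case (2 h s)
  then show ?case by (auto simp: all_le_Suc_iff)
next
  case (3 h s t p)
  let ?h = "h + step_value s"
  let ?turn = "\<lambda>h p i. Suc i < length p \<and> p ! i \<noteq> p ! Suc i \<and> 0 < h + height p (Suc i) \<longrightarrow>
    odd (h + height p (Suc i))"
  have nonneg: "(\<forall>k\<le>length (s # t # p). 0 \<le> h + height (s # t # p) k) \<longleftrightarrow>
      0 \<le> h \<and> (\<forall>k\<le>length (t # p). 0 \<le> ?h + height (t # p) k)"
    unfolding length_Cons[of s] all_le_Suc_iff[of "length (t # p)"] by (simp add: add.assoc)
  have turn_0: "?turn h (s # t # p) 0 \<longleftrightarrow> (s \<noteq> t \<and> 0 < ?h \<longrightarrow> odd ?h)"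
    by simp
  have turn_Suc: "?turn h (s # t # p) (Suc i) \<longleftrightarrow> ?turn ?h (t # p) i" for i
    by (simp add: add.assoc)
  have turns: "(\<forall>i. ?turn h (s # t # p) i) \<longleftrightarrow>
      (s \<noteq> t \<and> 0 < ?h \<longrightarrow> odd ?h) \<and> (\<forall>i. ?turn ?h (t # p) i)"
    by (subst all_nat_iff) (simp only: turn_0 turn_Suc)
  have final: "h + height (s # t # p) (length (s # t # p)) = ?h + height (t # p) (length (t # p))"
    by (simp add: add.assoc)
  show ?case
    unfolding admissible.simps(3) 3 nonneg turns final by (simp only: conj_ac)
qed

lemma admissible_0_iff:
  "admissible 0 p \<longleftrightarrow> dyck_path p \<and> no_positive_even_peak_or_valley p"
proof -
  have step_neq: "s \<noteq> t \<longleftrightarrow> s = U \<and> t = D \<or> s = D \<and> t = U" for s t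
    by (cases s; cases t) auto
  have "no_positive_even_peak_or_valley p \<longleftrightarrow>
     (\<forall>i. Suc i < length p \<and> p ! i \<noteq> p ! Suc i \<and> 0 < height p (Suc i) \<longrightarrow>
          odd (height p (Suc i)))"
    unfolding no_positive_even_peak_or_valley_def peak_at_height_def valley_at_height_def step_neq
    by blast
  then show ?thesis
    by (simp add: admissible_iff dyck_path_def)
qed

text \<open>The \<open>2 * N + 1\<close> letters are N pairs, the steps of the walk on levels, and
  one last letter, the D from height 1 to 0 that makes the walk end at level 0.\<close>

definition suffixes :: "nat \<Rightarrow> nat \<Rightarrow> step list set" where
  "suffixes N y = {q. length q = 2 * N + 1 \<and> admissible (2 * int y + 1) q}"

text \<open>The height after \<open>s\<close> is even, so \<open>t = s\<close> is forced while it is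
  positive. It is 0 only for \<open>s = D\<close> and \<open>y = 0\<close>, and then another D would
  reach -1; this gives the stationary step DU.\<close>

lemma admissible_two_steps:
  assumes "q \<noteq> []"
  shows "admissible (2 * int y + 1) (s # t # q) \<longleftrightarrow>
    s = U \<and> t = U \<and> admissible (2 * int (Suc y) + 1) q \<or>
    s = D \<and> (if y = 0 then t = U \<and> admissible 1 q
              else t = D \<and> admissible (2 * int (y - 1) + 1) q)"
proof -
  obtain u r where q: "q = u # r"
    using assms by (cases q) auto
  have neg: "\<not> admissible (-1) q"
    by (cases r) (auto simp: q)
  show ?thesis
  proof (cases y)
    case 0
    then show ?thesis
      using neg by (cases s; cases t) (auto simp: q)
  next
    case (Suc z)
    then show ?thesis
      by (cases s; cases t) (auto simp: q algebra_simps)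
  qed
qed

lemma suffixes_0: "suffixes 0 y = (if y = 0 then {[D]} else {})"
proof -
  have "q \<in> suffixes 0 y \<longleftrightarrow> y = 0 \<and> q = [D]" for q
  proof (cases "\<exists>s. q = [s]")
    case True
    then obtain s where "q = [s]" ..
    then show ?thesis
      by (cases s) (auto simp: suffixes_def)
  next
    case False
    then show ?thesis
      by (auto simp: suffixes_def length_Suc_conv)
  qed
  then show ?thesis by auto
qed

lemma suffixes_Suc:
  "suffixes (Suc N) y = (\<lambda>q. U # U # q) ` suffixes N (Suc y) \<union>
     (if y = 0 then (\<lambda>q. D # U # q) ` suffixes N 0 else (\<lambda>q. D # D # q) ` suffixes N (y - 1))"
    (is "_ = ?R")
proof (rule set_eqI)
  fix p
  show "p \<in> suffixes (Suc N) y \<longleftrightarrow> p \<in> ?R"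
  proof (cases "\<exists>s t q. p = s # t # q \<and> length q = 2 * N + 1")
    case True
    then obtain s t q where p: "p = s # t # q" and len: "length q = 2 * N + 1" by blast
    then have "q \<noteq> []" by auto
    from admissible_two_steps[OF this, of y s t] show ?thesis
      using len by (auto simp: p suffixes_def)
  next
    case False
    then have "p \<notin> suffixes (Suc N) y"
      by (auto simp: suffixes_def length_Suc_conv)
    moreover have "p \<notin> ?R"
      using False by (auto simp: suffixes_def)
    ultimately show ?thesis by blast
  qed
qed

text \<open>This is the recurrence at level 0, the two summands coming from the moves to level 1 and
  to level 0. For N = 0 level 1 is too far away, hence the value 0. Even N needs only Pascal's rule;
  for odd N the two middle coefficients are equal.\<close>

lemma central_choose_Suc:
  "Suc N choose (Suc N div 2) = (if N = 0 then 0 else N choose ((N - 1) div 2)) + (N choose (N div 2))"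
proof (cases "even N")
  case True
  then obtain j where "N = 2 * j" ..
  then show ?thesis by (cases j) auto
next
  case False
  then obtain j where N: "N = 2 * j + 1" by (elim oddE)
  have "N choose j = N choose Suc j"
    using binomial_symmetric[of j N] by (simp add: N)
  then show ?thesis by (simp add: N)
qed

lemma card_suffixes:
  "finite (suffixes N y) \<and>
   card (suffixes N y) = (if y \<le> N then N choose ((N - y) div 2) else 0)"
proof (induction N arbitrary: y)
  case 0
  then show ?case by (simp add: suffixes_0)
next
  case (Suc N)
  have fin: "finite (suffixes N z)"
    and card: "card (suffixes N z) = (if z \<le> N then N choose ((N - z) div 2) else 0)" for z
    using Suc by blast+
  have "card (suffixes (Suc N) y) =
      card (suffixes N (Suc y)) + card (suffixes N (if y = 0 then 0 else y - 1))"
    unfolding suffixes_Suc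
    by (subst card_Un_disjoint) (auto simp: fin card_image inj_on_def)
  also have "\<dots> = (if y \<le> Suc N then Suc N choose ((Suc N - y) div 2) else 0)"
  proof (cases "y = 0")
    case True
    then show ?thesis
      by (simp add: card central_choose_Suc Suc_le_eq del: binomial_Suc_Suc)
  next
    case False
    then obtain z where y: "y = Suc z"
      using not0_implies_Suc by blast
    show ?thesis
    proof (cases "z + 2 \<le> N")
      case True
      \<comment> \<open>The two neighbours of \<open>y\<close>, namely \<open>z\<close> and
        \<open>z + 2\<close>, thus have consecutive lower indices, as Pascal's rule
        requires.\<close>
      then have "(N - z) div 2 = Suc ((N - (z + 2)) div 2)"
        by (simp add: div_eq_dividend_iff flip: div_add_self2)
      with True show ?thesis by (simp add: card y)
    next
      case False
      \<comment> \<open>Level \<open>z + 2\<close> is out of reach in N steps. In the first two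
        cases the other lower indices are 0 and both sides are 1; in the third both sides are
        0.\<close>
      then have "z = N \<or> N = Suc z \<or> N < z" by auto
      then show ?thesis by (auto simp: card y)
    qed
  qed
  finally show ?case
    by (simp add: suffixes_Suc fin)
qed

lemma card_dyck:
  "card {p. dyck_path p \<and> has_semilength p (Suc N) \<and> no_positive_even_peak_or_valley p} =
   N choose (N div 2)" (is "card ?A = _")
proof -
  \<comment> \<open>The first letter must be U, and it leads to height 1, where a turn is allowed
    because 1 is odd.\<close>
  have "p \<in> ?A \<longleftrightarrow> p \<in> (#) U ` suffixes N 0" for p
  proof (cases "\<exists>s t q. p = s # t # q")
    case True
    then obtain s t q where p: "p = s # t # q" by blast
    have neg: "\<not> admissible (-1) (t # q)"
      by (cases q) auto
    have "p \<in> ?A \<longleftrightarrow> length p = 2 * Suc N \<and> admissible 0 p"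
      by (auto simp: has_semilength_def admissible_0_iff)
    also have "\<dots> \<longleftrightarrow> p \<in> (#) U ` suffixes N 0"
      using neg by (cases s) (auto simp: p suffixes_def)
    finally show ?thesis .
  next
    case False
    then have "length p < 2"
      \<comment> \<open>The rule serves only to split lists by length 0, 1, or at least 2.\<close>
      by (cases p rule: remdups_adj.cases) auto
    then show ?thesis
      by (auto simp: suffixes_def has_semilength_def)
  qed
  then have "?A = (#) U ` suffixes N 0" by blast
  then show ?thesis
    by (simp add: card_image card_suffixes)
qed

theorem proposition6:
  shows "(\<forall>n::nat. n \<ge> 1 \<longrightarrow>
            card {p. dyck_path p \<and> has_semilength p (2 * n) \<and> no_positive_even_peak_or_valley p}
              = (2 * n - 1) choose n)
       \<and> (\<forall>n::nat.
            card {p. dyck_path p \<and> has_semilength p (2 * n + 1) \<and> no_positive_even_peak_or_valley p}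
              = (2 * n) choose n)"
proof (intro conjI allI impI)
  fix n :: nat
  assume "n \<ge> 1"
  then obtain j where n: "n = Suc j"
    using not0_implies_Suc by fastforce
  \<comment> \<open>Halving the odd number \<open>2 * n - 1\<close> yields the lower index
    \<open>n - 1\<close>; symmetry turns it into \<open>n\<close>.\<close>
  have "(2 * j + 1) choose j = (2 * j + 1) choose Suc j"
    using binomial_symmetric[of j "2 * j + 1"] by simp
  then show "card {p. dyck_path p \<and> has_semilength p (2 * n) \<and> no_positive_even_peak_or_valley p}
      = (2 * n - 1) choose n"
    using card_dyck[of "2 * j + 1"] by (simp add: n)
next
  fix n :: nat
  show "card {p. dyck_path p \<and> has_semilength p (2 * n + 1) \<and> no_positive_even_peak_or_valley p}
      = (2 * n) choose n"
    using card_dyck[of "2 * n"] by simp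
qed

end
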